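(* Let $F:\mathbb{R}^n\times\mathbb{R}^m\to\mathbb{R}$ be continuously differentiable, with $\operatorname{Saddle}(F)\neq\emptyset$, and locally strictly convex-concave on $\operatorname{Saddle}(F)$. Then each isolated path connected component of $\operatorname{Saddle}(F)$ is locally asymptotically stable under the saddle-point dynamics $X_{\text{sp}}$ of $F$ and, moreover, the convergence of each trajectory is to a point.
   Context: Saddle-point dynamics: for a continuously differentiable $F:\mathbb{R}^n\times\mathbb{R}^m\to\mathbb{R}$ it is $\dot x=-\nabla_xF(x,z)$, $\dot z=\nabla_zF(x,z)$, with vector field denoted $X_{\text{sp}}$. Trajectories are solutions on $t\ge 0$. Saddle points: $(x_*,z_* )$ is a (local min-max) saddle point of $F$ if there are open neighborhoods $\mathcal U_{x_*}\subset\mathbb{R}^n$ of $x_*$ and $\mathcal U_{z_*}\subset\mathbb{R}^m$ of $z_*$ with $F(x_*,z)\le F(x_*,z_* )\le F(x,z_* )$ for all $z\in\mathcal U_{z_*}$, $x\in\mathcal U_{x_*}$. $\operatorname{Saddle}(F)$ is the set of all such points; it is assumed nonempty. Local convexity-concavity: $F$ is locally convex-concave at $(\tilde x,\tilde z)$ if there is an open neighborhood $\mathcal U$ of $(\tilde x,\tilde z)$ such that for all $(\bar x,\bar z)\in\mathcal U$ the function $x\mapsto F(x,\bar z)$ is convex over $\mathcal U\cap(\mathbb{R}^n\times\{\bar z\})$ and $z\mapsto F(\bar x,z)$ is concave over $\mathcal U\cap(\{\bar x\}\times\mathbb{R}^m)$. If in addition either $x\mapsto F(x,\tilde z)$ is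 strictly convex in an open neighborhood of $\tilde x$, or $z\mapsto F(\tilde x,z)$ is strictly concave in an open neighborhood of $\tilde z$, then $F$ is locally strictly convex-concave at $(\tilde x,\tilde z)$. $F$ is locally strictly convex-concave on a set if it is so at each point of the set. Isolated path connected component: $\mathcal S_c\subset\mathcal S\subset\mathbb{R}^k$ is an isolated path connected component of $\mathcal S$ if $\mathcal S_c$ is path connected and there is an open neighborhood $\mathcal U$ of $\mathcal S_c$ in $\mathbb{R}^k$ with $\mathcal U\cap\mathcal S=\mathcal S_c$. Stability: a set $\mathcal S$ of equilibria is locally asymptotically stable if (a) for every $\epsilon>0$ there is an open set $W\supset\mathcal S$ such that every trajectory starting in $W$ stays within distance less than $\epsilon$ of $\mathcal S$ for all $t\ge0$, and (b) there is an open set $W\supset\mathcal S$ such that the distance to $\mathcal S$ of every trajectory starting in $W$ tends to $0$ as $t\to\infty$. "Convergence is to a point" means that the trajectories starting in some open set containing $\mathcal S$ each converge to a single point of $\mathcal S$. *)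

theory Defs
  imports "HOL-Analysis.Analysis"
begin

definition continuously_differentiable :: "('a::euclidean_space \<Rightarrow> real) \<Rightarrow> bool" where
  "continuously_differentiable f \<longleftrightarrow>
     (\<exists>f'. (\<forall>x. GDERIV f x :> f' x) \<and> continuous_on UNIV f')"

text \<open>Meaningful only at points of differentiability, where the gradient is unique.\<close>

definition grad :: "('a::euclidean_space \<Rightarrow> real) \<Rightarrow> 'a \<Rightarrow> 'a" where
  "grad f x = (THE D. GDERIV f x :> D)"

definition saddle_point_field ::
    "('a::euclidean_space \<times> 'b::euclidean_space \<Rightarrow> real) \<Rightarrow> 'a \<times> 'b \<Rightarrow> 'a \<times> 'b" where
  "saddle_point_field F = (\<lambda>(x, z). (- grad (\<lambda>y. F (y, z)) x, grad (\<lambda>w. F (x, w)) z))"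

definition is_saddle_point ::
    "('a::euclidean_space \<times> 'b::euclidean_space \<Rightarrow> real) \<Rightarrow> 'a \<times> 'b \<Rightarrow> bool" where
  "is_saddle_point F = (\<lambda>(xs, zs).
     \<exists>U V. open U \<and> xs \<in> U \<and> open V \<and> zs \<in> V \<and>
       (\<forall>x\<in>U. \<forall>z\<in>V. F (xs, z) \<le> F (xs, zs) \<and> F (xs, zs) \<le> F (x, zs)))"

definition Saddle ::
    "('a::euclidean_space \<times> 'b::euclidean_space \<Rightarrow> real) \<Rightarrow> ('a \<times> 'b) set" where
  "Saddle F = {p. is_saddle_point F p}"

definition strictly_convex_on :: "'a::real_vector set \<Rightarrow> ('a \<Rightarrow> real) \<Rightarrow> bool" where
  "strictly_convex_on S f \<longleftrightarrow> convex S \<and>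
     (\<forall>x\<in>S. \<forall>y\<in>S. \<forall>u>0. \<forall>v>0. x \<noteq> y \<longrightarrow> u + v = 1 \<longrightarrow>
        f (u *\<^sub>R x + v *\<^sub>R y) < u * f x + v * f y)"

definition strictly_concave_on :: "'a::real_vector set \<Rightarrow> ('a \<Rightarrow> real) \<Rightarrow> bool" where
  "strictly_concave_on S f \<longleftrightarrow> strictly_convex_on S (\<lambda>x. - f x)"

text \<open>\<^const>\<open>convex_on\<close> also demands that its set be convex, so the slices of the neighbourhood
  are required to be convex here. Shrinking the neighbourhood to a ball shows that this is no
  restriction; the same applies to the strict variants.\<close>

definition locally_convex_concave_at ::
    "('a::euclidean_space \<times> 'b::euclidean_space \<Rightarrow> real) \<Rightarrow> 'a \<times> 'b \<Rightarrow> bool" where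
  "locally_convex_concave_at F p \<longleftrightarrow>
     (\<exists>U. open U \<and> p \<in> U \<and>
       (\<forall>(xb, zb)\<in>U. convex_on {x. (x, zb) \<in> U} (\<lambda>x. F (x, zb)) \<and>
                     concave_on {z. (xb, z) \<in> U} (\<lambda>z. F (xb, z))))"

definition locally_strictly_convex_concave_at ::
    "('a::euclidean_space \<times> 'b::euclidean_space \<Rightarrow> real) \<Rightarrow> 'a \<times> 'b \<Rightarrow> bool" where
  "locally_strictly_convex_concave_at F = (\<lambda>(xt, zt).
     locally_convex_concave_at F (xt, zt) \<and>
     ((\<exists>U. open U \<and> xt \<in> U \<and> strictly_convex_on U (\<lambda>x. F (x, zt))) \<or>
      (\<exists>V. open V \<and> zt \<in> V \<and> strictly_concave_on V (\<lambda>z. F (xt, z)))))"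

definition locally_strictly_convex_concave_on ::
    "('a::euclidean_space \<times> 'b::euclidean_space) set \<Rightarrow> ('a \<times> 'b \<Rightarrow> real) \<Rightarrow> bool" where
  "locally_strictly_convex_concave_on S F \<longleftrightarrow> (\<forall>p\<in>S. locally_strictly_convex_concave_at F p)"

definition isolated_path_component :: "'a::euclidean_space set \<Rightarrow> 'a set \<Rightarrow> bool" where
  "isolated_path_component Sc S \<longleftrightarrow>
     Sc \<subseteq> S \<and> path_connected Sc \<and> (\<exists>U. open U \<and> Sc \<subseteq> U \<and> U \<inter> S = Sc)"

text \<open>Values of a trajectory at negative times are irrelevant; at time 0 the derivative is
  one-sided. Solutions need not be unique, since the field is only assumed continuous.\<close>

definition trajectory :: "('a::euclidean_space \<Rightarrow> 'a) \<Rightarrow> (real \<Rightarrow> 'a) \<Rightarrow> bool" where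
  "trajectory X \<phi> \<longleftrightarrow>
     (\<forall>t\<ge>0. (\<phi> has_vector_derivative X (\<phi> t)) (at t within {0..}))"

definition locally_asymptotically_stable ::
    "('a::euclidean_space \<Rightarrow> 'a) \<Rightarrow> 'a set \<Rightarrow> bool" where
  "locally_asymptotically_stable X S \<longleftrightarrow>
     (\<forall>p\<in>S. X p = 0) \<and>
     (\<forall>\<epsilon>>0. \<exists>W. open W \<and> S \<subseteq> W \<and>
        (\<forall>\<phi>. trajectory X \<phi> \<and> \<phi> 0 \<in> W \<longrightarrow> (\<forall>t\<ge>0. infdist (\<phi> t) S < \<epsilon>))) \<and>
     (\<exists>W. open W \<and> S \<subseteq> W \<and>
        (\<forall>\<phi>. trajectory X \<phi> \<and> \<phi> 0 \<in> W \<longrightarrow> ((\<lambda>t. infdist (\<phi> t) S) \<longlongrightarrow> 0) at_top))"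

definition convergence_to_a_point :: "('a::euclidean_space \<Rightarrow> 'a) \<Rightarrow> 'a set \<Rightarrow> bool" where
  "convergence_to_a_point X S \<longleftrightarrow>
     (\<exists>W. open W \<and> S \<subseteq> W \<and>
        (\<forall>\<phi>. trajectory X \<phi> \<and> \<phi> 0 \<in> W \<longrightarrow> (\<exists>p\<in>S. (\<phi> \<longlongrightarrow> p) at_top)))"

end

theory Submission
  imports Defs
begin

text \<open>Near a saddle point the squared distance to it is a Lyapunov function, by convexity-concavity.
  Since the field is merely continuous, solutions may be non-unique and the LaSalle invariance
  principle is replaced by two Barbalat arguments at a limit point: one shows that the dissipation
  vanishes there, the other, applied to the component that has become constant on the limit set,
  that the remaining component of the field vanishes. Limit points are thus saddle points, and each
  of them attracts the trajectory since saddle points are Lyapunov stable.\<close>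

section \<open>Limit points of trajectories\<close>

text \<open>The usual omega-limit set, encoded by recurring visits rather than by sequences of
  times, so that it combines directly with properties that hold eventually.\<close>

definition omega_limit :: "(real \<Rightarrow> 'a::metric_space) \<Rightarrow> 'a set" where
  "omega_limit \<phi> = {q. \<forall>\<delta>>0. \<exists>\<^sub>F t in at_top. dist (\<phi> t) q < \<delta>}"

text \<open>If no point of \<open>K\<close> were a limit point, each would have a ball that
  \<open>\<phi>\<close> eventually avoids. Finitely many of these balls cover \<open>K\<close>, so
  \<open>\<phi>\<close> would eventually avoid \<open>K\<close>.\<close>

lemma omega_limit_meets_compact:
  assumes "compact K" and freq: "\<exists>\<^sub>F t in at_top. \<phi> t \<in> K"
  shows "K \<inter> omega_limit \<phi> \<noteq> {}"
proof
  assume "K \<inter> omega_limit \<phi> = {}"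
  then have "\<forall>q\<in>K. \<exists>\<delta>>0. \<forall>\<^sub>F t in at_top. \<not> dist (\<phi> t) q < \<delta>"
    unfolding omega_limit_def frequently_def by blast
  then obtain d where d: "\<And>q. q \<in> K \<Longrightarrow> d q > 0"
    "\<And>q. q \<in> K \<Longrightarrow> \<forall>\<^sub>F t in at_top. \<not> dist (\<phi> t) q < d q"
    by metis
  have "K \<subseteq> (\<Union>q\<in>K. ball q (d q))"
    using d(1) by (meson UN_I centre_in_ball subsetI)
  then obtain Q where Q: "Q \<subseteq> K" "finite Q" "K \<subseteq> (\<Union>q\<in>Q. ball q (d q))"
    using compactE_image[OF \<open>compact K\<close>, of K "\<lambda>q. ball q (d q)"] by blast
  have "\<forall>\<^sub>F t in at_top. \<forall>q\<in>Q. \<not> dist (\<phi> t) q < d q"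
    using Q d by (intro eventually_ball_finite) auto
  then have "\<forall>\<^sub>F t in at_top. \<phi> t \<notin> K"
    by (rule eventually_mono) (use Q(3) in \<open>auto simp: dist_commute\<close>)
  with freq show False
    by (simp add: frequently_def)
qed

lemma omega_limit_subset_closed:
  assumes "closed K" and "\<forall>\<^sub>F t in at_top. \<phi> t \<in> K"
  shows "omega_limit \<phi> \<subseteq> K"
proof
  fix q assume q: "q \<in> omega_limit \<phi>"
  have "\<exists>y\<in>K. dist y q < \<delta>" if "\<delta> > 0" for \<delta>
  proof -
    have "\<exists>\<^sub>F t in at_top. dist (\<phi> t) q < \<delta>"
      using q that by (simp add: omega_limit_def)
    then have "\<exists>\<^sub>F t in at_top. dist (\<phi> t) q < \<delta> \<and> \<phi> t \<in> K"
      using assms(2) by (rule frequently_eventually_frequently)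
    then show ?thesis
      using frequently_ex by blast
  qed
  then show "q \<in> K"
    using assms(1) by (metis closed_approachable)
qed

text \<open>If convergence fails, \<open>\<phi>\<close> keeps returning to the compact part of
  \<open>K\<close> where \<open>f\<close> is at distance at least \<open>e\<close> from
  \<open>c\<close>. That part then contains a limit point, which is a contradiction.\<close>

lemma tendsto_of_omega_limit:
  fixes f :: "'a::metric_space \<Rightarrow> 'b::metric_space"
  assumes "compact K" and "\<forall>\<^sub>F t in at_top. \<phi> t \<in> K" and "continuous_on K f"
    and "\<And>q. q \<in> omega_limit \<phi> \<Longrightarrow> f q = c"
  shows "((\<lambda>t. f (\<phi> t)) \<longlongrightarrow> c) at_top"
proof (rule ccontr)
  assume "\<not> ((\<lambda>t. f (\<phi> t)) \<longlongrightarrow> c) at_top"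
  then obtain e where e: "e > 0" "\<exists>\<^sub>F t in at_top. dist (f (\<phi> t)) c \<ge> e"
    unfolding tendsto_iff not_eventually not_less by (auto simp: not_eventually not_less)
  define C where "C = K \<inter> (\<lambda>y. dist (f y) c) -` {e..}"
  have "closed C"
    unfolding C_def using assms(1,3)
    by (intro continuous_closed_preimage continuous_intros) (auto intro: compact_imp_closed)
  then have "compact C"
    using assms(1) by (metis C_def compact_Int_closed inf.idem inf_assoc)
  moreover have "\<exists>\<^sub>F t in at_top. \<phi> t \<in> C"
    using frequently_eventually_conj[OF e(2) assms(2)]
    by (rule frequently_elim1) (auto simp: C_def)
  ultimately obtain q where "q \<in> C" "q \<in> omega_limit \<phi>"
    using omega_limit_meets_compact by blast
  then show False
    using e(1) assms(4) by (auto simp: C_def)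
qed

text \<open>A Barbalat-type argument: otherwise \<^term>\<open>u\<close> would drop by a fixed amount on time intervals of
  fixed length that start arbitrarily late.\<close>

lemma omega_limit_derivative_bound_nonneg:
  fixes u :: "real \<Rightarrow> real"
  assumes lip: "L-lipschitz_on {0..} \<phi>" and q: "q \<in> omega_limit \<phi>" and h: "isCont h q"
    and u: "\<And>t. t > 0 \<Longrightarrow> (u has_real_derivative u' t) (at t)"
    and le: "\<And>t. t > 0 \<Longrightarrow> u' t \<le> h (\<phi> t)"
    and lim: "(u \<longlongrightarrow> c) at_top"
  shows "h q \<ge> 0"
proof (rule ccontr)
  assume "\<not> h q \<ge> 0"
  define m where "m = - h q / 2"
  have m: "m > 0" "h q < - m"
    using \<open>\<not> h q \<ge> 0\<close> by (auto simp: m_def)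
  then have "\<forall>\<^sub>F y in nhds q. h y < - m"
    using h by (metis isCont_def tendsto_at_iff_tendsto_nhds order_tendstoD(2))
  then obtain \<delta> where \<delta>: "\<delta> > 0" "\<And>y. dist y q < \<delta> \<Longrightarrow> h y < - m"
    by (auto simp: eventually_nhds_metric)
  have "L \<ge> 0"
    using lip by (rule lipschitz_on_nonneg)
  \<comment> \<open>A time span in which an \<open>L\<close>-Lipschitz curve moves by less than
    \<open>\<delta> / 2\<close>, hence cannot go from the half-radius ball out of the
    \<open>\<delta>\<close>-ball. Dividing by \<open>L + 1\<close> covers the case
    \<open>L = 0\<close>.\<close>
  define \<tau> where "\<tau> = \<delta> / (2 * (L + 1))"
  have \<tau>: "\<tau> > 0" "L * \<tau> < \<delta> / 2"
    using \<delta>(1) \<open>L \<ge> 0\<close> by (auto simp: \<tau>_def field_simps)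
  \<comment> \<open>Two values of \<open>u\<close> this close to \<open>c\<close> differ by less
    than \<open>m * \<tau>\<close>, which is the drop that the slope bound will force.\<close>
  have "\<forall>\<^sub>F t in at_top. dist (u t) c < m * \<tau> / 2"
    using m(1) \<tau>(1) by (intro tendstoD[OF lim]) simp
  then obtain N where N: "\<And>t. t \<ge> N \<Longrightarrow> dist (u t) c < m * \<tau> / 2"
    by (auto simp: eventually_at_top_linorder)
  have "\<exists>\<^sub>F t in at_top. dist (\<phi> t) q < \<delta> / 2"
    using q \<delta>(1) half_gt_zero[of \<delta>] unfolding omega_limit_def by blast
  \<comment> \<open>The bound 1 keeps \<open>t\<close> positive, where the derivative of
    \<open>u\<close> is available.\<close>
  then have "\<exists>\<^sub>F t in at_top. dist (\<phi> t) q < \<delta> / 2 \<and> t \<ge> max 1 N"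
    by (rule frequently_eventually_frequently) (rule eventually_ge_at_top)
  then obtain t where t: "dist (\<phi> t) q < \<delta> / 2" "t \<ge> 1" "t \<ge> N"
    using frequently_ex by force
  have near: "dist (\<phi> s) q < \<delta>" if "t \<le> s" "s \<le> t + \<tau>" for s
  proof -
    have "dist (\<phi> s) (\<phi> t) \<le> L * dist s t"
      using lip that t by (intro lipschitz_onD) auto
    also have "\<dots> \<le> L * \<tau>"
      using that \<open>L \<ge> 0\<close> by (intro mult_left_mono) (auto simp: dist_real_def)
    finally show ?thesis
      using \<tau>(2) t(1) dist_triangle[of "\<phi> s" q "\<phi> t"] by linarith
  qed
  have "u t + m * t \<ge> u (t + \<tau>) + m * (t + \<tau>)"
  proof (rule DERIV_nonpos_imp_nonincreasing[of t "t + \<tau>" "\<lambda>s. u s + m * s"])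
    fix s assume s: "t \<le> s" "s \<le> t + \<tau>"
    have "u' s + m \<le> 0"
      using le[of s] \<delta>(2)[OF near[OF s]] s t by linarith
    moreover have "((\<lambda>s. u s + m * s) has_real_derivative u' s + m) (at s)"
      using u[of s] s t by (auto intro!: derivative_eq_intros)
    ultimately show "\<exists>y. ((\<lambda>s. u s + m * s) has_real_derivative y) (at s) \<and> y \<le> 0"
      by blast
  qed (use \<tau> in auto)
  then have "u (t + \<tau>) \<le> u t - m * \<tau>"
    by (simp add: algebra_simps)
  moreover have "dist (u t) c < m * \<tau> / 2" "dist (u (t + \<tau>)) c < m * \<tau> / 2"
    using N t \<tau>(1) by auto
  ultimately show False
    unfolding dist_real_def by linarith
qed

section \<open>Trajectories near a point where the field is dissipative\<close>

lemma trajectory_has_vector_derivative: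
  assumes "trajectory X \<phi>" "t > 0"
  shows "(\<phi> has_vector_derivative X (\<phi> t)) (at t)"
proof -
  have "(\<phi> has_vector_derivative X (\<phi> t)) (at t within {0..})"
    using assms by (simp add: trajectory_def)
  moreover have "at t within {0..} = at t"
    using assms(2) by (intro at_within_interior) (simp add: interior_real_atLeast)
  ultimately show ?thesis
    by simp
qed

lemma trajectory_continuous_on: "trajectory X \<phi> \<Longrightarrow> continuous_on {0..} \<phi>"
  by (auto simp: trajectory_def continuous_on_eq_continuous_within
      intro: has_vector_derivative_continuous)

text \<open>The field, and with it the speed, is bounded on the compact set. The constant obtained
  feeds the Barbalat argument.\<close>

lemma trajectory_lipschitz_on:
  assumes "trajectory X \<phi>" and "continuous_on K X" and "compact K"
    and "\<And>t. t \<ge> 0 \<Longrightarrow> \<phi> t \<in> K"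
  shows "\<exists>L. L-lipschitz_on {0..} \<phi>"
proof -
  have "bounded (X ` K)"
    using assms(2,3) by (simp add: compact_continuous_image compact_imp_bounded)
  then obtain L where L: "L > 0" "\<And>y. y \<in> K \<Longrightarrow> norm (X y) \<le> L"
    by (auto simp: bounded_pos)
  have "norm (\<phi> t - \<phi> s) \<le> L * norm (t - s)" if "t \<ge> 0" "s \<ge> 0" for t s
  proof (rule differentiable_bound[where S = "{0..}" and f' = "\<lambda>t h. h *\<^sub>R X (\<phi> t)"])
    fix \<tau> :: real assume "\<tau> \<in> {0..}"
    then show "(\<phi> has_derivative (\<lambda>h. h *\<^sub>R X (\<phi> \<tau>))) (at \<tau> within {0..})"
      using assms(1) by (simp add: trajectory_def has_vector_derivative_def)
    show "onorm (\<lambda>h. h *\<^sub>R X (\<phi> \<tau>)) \<le> L"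
      using L assms(4) \<open>\<tau> \<in> {0..}\<close>
      by (intro onorm_le) (auto simp: mult.commute[of _ "norm (X _)"] intro!: mult_right_mono)
  qed (use that in auto)
  then have "L-lipschitz_on {0..} \<phi>"
    using L(1) by (intro lipschitz_onI) (auto simp: dist_norm)
  then show ?thesis
    by blast
qed

lemma trajectory_square_distance_derivative:
  assumes "trajectory X \<phi>" "t > 0"
  shows "((\<lambda>t. (dist (\<phi> t) p)\<^sup>2) has_real_derivative 2 * (X (\<phi> t) \<bullet> (\<phi> t - p))) (at t)"
proof -
  have "((\<lambda>t. (\<phi> t - p) \<bullet> (\<phi> t - p)) has_derivative (\<lambda>h. (\<phi> t - p) \<bullet> (h *\<^sub>R X (\<phi> t)) + (h *\<^sub>R X (\<phi> t)) \<bullet> (\<phi> t - p))) (at t)"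
    using trajectory_has_vector_derivative[OF assms]
    by (auto simp: has_vector_derivative_def intro!: derivative_eq_intros)
  moreover have "(\<lambda>h. (\<phi> t - p) \<bullet> (h *\<^sub>R X (\<phi> t)) + (h *\<^sub>R X (\<phi> t)) \<bullet> (\<phi> t - p))
      = (*) (2 * (X (\<phi> t) \<bullet> (\<phi> t - p)))"
    by (simp add: fun_eq_iff inner_commute)
  ultimately show ?thesis
    by (simp add: has_field_derivative_def dist_norm power2_norm_eq_inner)
qed

text \<open>Dissipation is known only inside the ball, so escape has to be excluded along with
  growth. Up to the first time a suitable level is reached, the trajectory is inside the ball and
  the squared distance cannot have grown to that level.\<close>

lemma dissipative_dist_antimono:
  assumes \<phi>: "trajectory X \<phi>"
    and diss: "\<And>y. y \<in> ball p r \<Longrightarrow> X y \<bullet> (y - p) \<le> 0"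
    and "0 \<le> s" "s \<le> t" "\<phi> s \<in> ball p r"
  shows "dist (\<phi> t) p \<le> dist (\<phi> s) p"
proof (rule ccontr)
  assume "\<not> dist (\<phi> t) p \<le> dist (\<phi> s) p"
  \<comment> \<open>This level lies above the distance at time \<open>s\<close>, is reached by time
    \<open>t\<close>, and is at most \<open>r\<close>, so that below it the trajectory is in the
    ball.\<close>
  define c where "c = min r (dist (\<phi> t) p)"
  have c: "dist (\<phi> s) p < c" "c \<le> r" "c \<le> dist (\<phi> t) p"
    using \<open>\<phi> s \<in> ball p r\<close> \<open>\<not> dist (\<phi> t) p \<le> dist (\<phi> s) p\<close> by (auto simp: c_def dist_commute)
  have cont: "continuous_on {s..t'} (\<lambda>\<tau>. dist (\<phi> \<tau>) p)" for t'
    using trajectory_continuous_on[OF \<phi>] \<open>0 \<le> s\<close>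
    by (intro continuous_intros) (auto intro: continuous_on_subset)
  define C where "C = {s..t} \<inter> (\<lambda>\<tau>. dist (\<phi> \<tau>) p) -` {c..}"
  have "closed C"
    unfolding C_def by (intro continuous_closed_preimage cont) auto
  then have "compact C"
    by (metis C_def compact_Icc compact_Int_closed inf.idem inf_assoc)
  moreover have "t \<in> C"
    using c \<open>s \<le> t\<close> by (auto simp: C_def)
  ultimately obtain b where b: "b \<in> C" "\<And>\<tau>. \<tau> \<in> C \<Longrightarrow> b \<le> \<tau>"
    using compact_attains_inf[of C] by blast
  \<comment> \<open>The derivative is used only strictly between \<open>s\<close> and
    \<open>b\<close>: at \<open>s = 0\<close> it is one-sided, and at \<open>b\<close> the
    trajectory may already be on the sphere. Continuity covers the endpoints.\<close>
  have "(dist (\<phi> b) p)\<^sup>2 \<le> (dist (\<phi> s) p)\<^sup>2"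
  proof (rule DERIV_nonpos_imp_decreasing_open[of s b "\<lambda>\<tau>. (dist (\<phi> \<tau>) p)\<^sup>2"])
    fix \<tau> assume \<tau>: "s < \<tau>" "\<tau> < b"
    have "\<tau> \<notin> C"
      using b(2)[of \<tau>] \<tau> by auto
    then have "\<phi> \<tau> \<in> ball p r"
      using \<tau> b(1) c by (auto simp: C_def dist_commute)
    then show "\<exists>y. ((\<lambda>\<tau>. (dist (\<phi> \<tau>) p)\<^sup>2) has_real_derivative y) (at \<tau>) \<and> y \<le> 0"
      using trajectory_square_distance_derivative[OF \<phi>, of \<tau> p] diss \<tau> \<open>0 \<le> s\<close> by fastforce
  next
    show "continuous_on {s..b} (\<lambda>\<tau>. (dist (\<phi> \<tau>) p)\<^sup>2)"
      by (intro continuous_on_power cont)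
  qed (use b in \<open>auto simp: C_def\<close>)
  then have "dist (\<phi> b) p \<le> dist (\<phi> s) p"
    by (simp add: power2_le_iff_abs_le)
  then show False
    using b(1) c(1) by (auto simp: C_def)
qed

lemma antimono_bounded_below_convergent_at_top:
  fixes u :: "real \<Rightarrow> real"
  assumes anti: "\<And>s t. 0 \<le> s \<Longrightarrow> s \<le> t \<Longrightarrow> u t \<le> u s" and bound: "\<And>t. t \<ge> 0 \<Longrightarrow> b \<le> u t"
  shows "\<exists>c. (u \<longlongrightarrow> c) at_top"
proof -
  define c where "c = Inf (u ` {0..})"
  have bdd: "bdd_below (u ` {0..})"
    using bound by (intro bdd_belowI2) auto
  have "\<forall>\<^sub>F t in at_top. dist (u t) c < e" if e: "e > 0" for e
  proof -
    obtain s where s: "s \<ge> 0" "u s < c + e"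
      using cInf_lessD[of "u ` {0..}" "c + e"] e by (auto simp: c_def)
    have "dist (u t) c < e" if "t \<ge> s" for t
    proof -
      have "c \<le> u t"
        unfolding c_def using bdd s that by (intro cInf_lower) auto
      then show ?thesis
        using anti[of s t] s that by (auto simp: dist_real_def)
    qed
    then show ?thesis
      by (auto simp: eventually_at_top_linorder)
  qed
  then show ?thesis
    by (auto simp: tendsto_iff)
qed

text \<open>Since \<open>f\<close> is constant on the limit set, \<open>f (\<phi> t)\<close>
  converges, and Barbalat forces its velocity to vanish at limit points. This stands in for the
  invariance of the limit set.\<close>

lemma omega_limit_linear_image_zero:
  fixes f :: "'a::euclidean_space \<Rightarrow> 'b::euclidean_space"
  assumes \<phi>: "trajectory X \<phi>" and X: "continuous_on UNIV X" and K: "compact K"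
    and in_K: "\<And>t. t \<ge> 0 \<Longrightarrow> \<phi> t \<in> K"
    and f: "bounded_linear f" and const: "\<And>q. q \<in> omega_limit \<phi> \<Longrightarrow> f q = c"
    and q: "q \<in> omega_limit \<phi>"
  shows "f (X q) = 0"
proof -
  interpret f: bounded_linear f by (rule f)
  \<comment> \<open>With this direction, the one-sided bound from Barbalat says that minus the
    squared norm of \<open>f (X q)\<close> is nonnegative.\<close>
  define a where "a = - f (X q)"
  obtain L where L: "L-lipschitz_on {0..} \<phi>"
    using trajectory_lipschitz_on[OF \<phi> continuous_on_subset[OF X] K in_K] by auto
  have "((\<lambda>t. f (\<phi> t)) \<longlongrightarrow> c) at_top"
    using in_K const
    by (intro tendsto_of_omega_limit[OF K] f.continuous_on) (auto simp: eventually_at_top_linorder)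
  then have lim: "((\<lambda>t. a \<bullet> f (\<phi> t)) \<longlongrightarrow> a \<bullet> c) at_top"
    by (intro tendsto_intros)
  have "a \<bullet> f (X q) \<ge> 0"
  proof (rule omega_limit_derivative_bound_nonneg[OF L q _ _ _ lim])
    show "isCont (\<lambda>y. a \<bullet> f (X y)) q"
      using X f.isCont by (auto intro!: continuous_intros simp: continuous_on_eq_continuous_at)
    fix t :: real assume "t > 0"
    have "((\<lambda>t. a \<bullet> f (\<phi> t)) has_vector_derivative a \<bullet> f (X (\<phi> t))) (at t)"
      by (intro bounded_linear.has_vector_derivative[OF bounded_linear_inner_right]
          f.has_vector_derivative trajectory_has_vector_derivative \<phi> \<open>t > 0\<close>)
    then show "((\<lambda>t. a \<bullet> f (\<phi> t)) has_real_derivative a \<bullet> f (X (\<phi> t))) (at t)"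
      by (simp add: has_real_derivative_iff_has_vector_derivative)
  qed simp
  then have "f (X q) \<bullet> f (X q) \<le> 0"
    by (simp add: a_def)
  then show ?thesis
    by (metis inner_ge_zero inner_eq_zero_iff order_antisym)
qed

text \<open>The squared distance to \<open>p\<close> decreases, hence converges, and its derivative
  is at most \<open>2 * g\<close>. Barbalat makes \<open>g\<close> nonnegative at limit points,
  where it is also nonpositive.\<close>

lemma omega_limit_dissipation_zero:
  assumes \<phi>: "trajectory X \<phi>" and X: "continuous_on UNIV X" and g: "continuous_on UNIV g"
    and diss: "\<And>y. y \<in> ball p r \<Longrightarrow> X y \<bullet> (y - p) \<le> g y" "\<And>y. y \<in> ball p r \<Longrightarrow> g y \<le> 0"
    and start: "\<phi> 0 \<in> ball p r" and q: "q \<in> omega_limit \<phi>"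
  shows "q \<in> ball p r" "g q = 0"
proof -
  have diss0: "X y \<bullet> (y - p) \<le> 0" if "y \<in> ball p r" for y
    using diss that by force
  have anti: "dist (\<phi> t) p \<le> dist (\<phi> s) p" if "0 \<le> s" "s \<le> t" "\<phi> s \<in> ball p r" for s t
    using dissipative_dist_antimono[OF \<phi> diss0] that by blast
  \<comment> \<open>The trajectory never leaves this closed ball. It is compact and lies inside the
    open one, so limit points stay where the dissipation bounds hold.\<close>
  define K where "K = cball p (dist (\<phi> 0) p)"
  have K: "compact K" "K \<subseteq> ball p r"
    using start by (auto simp: K_def dist_commute)
  have in_K: "\<phi> t \<in> K" if "t \<ge> 0" for t
    using anti[of 0 t] that start by (auto simp: K_def dist_commute)
  have "q \<in> K"
    using omega_limit_subset_closed[OF compact_imp_closed[OF K(1)], of \<phi>] in_K q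
    by (metis eventually_at_top_linorder subsetD)
  then show "q \<in> ball p r"
    using K by blast
  obtain L where L: "L-lipschitz_on {0..} \<phi>"
    using trajectory_lipschitz_on[OF \<phi> continuous_on_subset[OF X] K(1) in_K] by auto
  have "\<exists>c. ((\<lambda>t. (dist (\<phi> t) p)\<^sup>2) \<longlongrightarrow> c) at_top"
    using subsetD[OF K(2) in_K]
    by (intro antimono_bounded_below_convergent_at_top[of _ 0] power_mono anti) auto
  then obtain c where c: "((\<lambda>t. (dist (\<phi> t) p)\<^sup>2) \<longlongrightarrow> c) at_top" ..
  have "2 * g q \<ge> 0"
  proof (rule omega_limit_derivative_bound_nonneg[OF L q _ _ _ c])
    show "isCont (\<lambda>y. 2 * g y) q"
      using g by (auto intro!: continuous_intros simp: continuous_on_eq_continuous_at)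
    show "2 * (X (\<phi> t) \<bullet> (\<phi> t - p)) \<le> 2 * g (\<phi> t)" if "t > 0" for t
      using diss(1)[of "\<phi> t"] in_K[of t] K(2) that by auto
  qed (rule trajectory_square_distance_derivative[OF \<phi>])
  then show "g q = 0"
    using diss(2)[OF \<open>q \<in> ball p r\<close>] by simp
qed

section \<open>Gradients of convex-concave functions\<close>

lemma grad_eq:
  assumes "GDERIV f x :> D"
  shows "grad f x = D"
  unfolding grad_def
proof (rule the_equality)
  fix D' assume "GDERIV f x :> D'"
  then have "(\<lambda>h. h \<bullet> D') = (\<lambda>h. h \<bullet> D)"
    using assms unfolding gderiv_def by (rule has_derivative_unique)
  then show "D' = D"
    by (metis inner_commute vector_eq_rdot)
qed (rule assms)

lemma GDERIV_fst:
  assumes "GDERIV F (x, z) :> D"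
  shows "GDERIV (\<lambda>x. F (x, z)) x :> fst D"
proof -
  have "((\<lambda>x. (x, z)) has_derivative (\<lambda>h. (h, 0))) (at x)"
    by (auto intro!: derivative_eq_intros)
  moreover have "(F has_derivative (\<lambda>h. h \<bullet> D)) (at (x, z))"
    using assms by (simp add: gderiv_def)
  ultimately have "((\<lambda>x. F (x, z)) has_derivative (\<lambda>h. (h, 0) \<bullet> D)) (at x)"
    by (rule has_derivative_compose)
  then show ?thesis
    by (simp add: gderiv_def inner_prod_def)
qed

lemma GDERIV_snd:
  assumes "GDERIV F (x, z) :> D"
  shows "GDERIV (\<lambda>z. F (x, z)) z :> snd D"
proof -
  have "((\<lambda>z. (x, z)) has_derivative (\<lambda>h. (0, h))) (at z)"
    by (auto intro!: derivative_eq_intros)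
  moreover have "(F has_derivative (\<lambda>h. h \<bullet> D)) (at (x, z))"
    using assms by (simp add: gderiv_def)
  ultimately have "((\<lambda>z. F (x, z)) has_derivative (\<lambda>h. (0, h) \<bullet> D)) (at z)"
    by (rule has_derivative_compose)
  then show ?thesis
    by (simp add: gderiv_def inner_prod_def)
qed

lemma saddle_point_field_eq:
  assumes "\<And>y. GDERIV F y :> G y"
  shows "saddle_point_field F = (\<lambda>y. (- fst (G y), snd (G y)))"
proof
  fix y
  show "saddle_point_field F y = (- fst (G y), snd (G y))"
    using grad_eq[OF GDERIV_fst[OF assms]] grad_eq[OF GDERIV_snd[OF assms]]
    by (cases y) (simp add: saddle_point_field_def)
qed

section \<open>First-order conditions for extrema and for convexity\<close>

lemma GDERIV_local_min_zero:
  assumes "GDERIV f x :> D" "open S" "x \<in> S" "\<And>y. y \<in> S \<Longrightarrow> f x \<le> f y"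
  shows "D = 0"
proof -
  have "(\<lambda>h. h \<bullet> D) = (\<lambda>h. 0)"
    using assms unfolding gderiv_def by (intro differential_zero_maxmin) auto
  then show ?thesis
    by (metis inner_eq_zero_iff)
qed

lemma GDERIV_local_max_zero:
  assumes "GDERIV f x :> D" "open S" "x \<in> S" "\<And>y. y \<in> S \<Longrightarrow> f y \<le> f x"
  shows "D = 0"
  using GDERIV_local_min_zero[OF GDERIV_minus[OF assms(1)], of S] assms by auto

text \<open>Convexity bounds the difference quotients along the segment from \<open>x\<close>
  towards \<open>y\<close> by \<open>f y - f x\<close>; their limit from the right is the
  directional derivative.\<close>

lemma convex_on_gradient_le:
  assumes f: "convex_on S f" and D: "GDERIV f x :> D" and "x \<in> S" "y \<in> S"
  shows "f x + (y - x) \<bullet> D \<le> f y"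
proof -
  have "((\<lambda>t. x + t *\<^sub>R (y - x)) has_derivative (\<lambda>h. h *\<^sub>R (y - x))) (at 0)"
    by (auto intro!: derivative_eq_intros)
  moreover have "(f has_derivative (\<lambda>h. h \<bullet> D)) (at (x + 0 *\<^sub>R (y - x)))"
    using D by (simp add: gderiv_def)
  ultimately have "((\<lambda>t. f (x + t *\<^sub>R (y - x))) has_derivative (\<lambda>h. (h *\<^sub>R (y - x)) \<bullet> D)) (at 0)"
    by (rule has_derivative_compose)
  then have "((\<lambda>t. f (x + t *\<^sub>R (y - x))) has_real_derivative (y - x) \<bullet> D) (at 0)"
    by (rule has_derivative_imp_has_field_derivative) simp
  then have "((\<lambda>t. (f (x + t *\<^sub>R (y - x)) - f x) / t) \<longlongrightarrow> (y - x) \<bullet> D) (at_right 0)"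
    by (auto simp: has_field_derivative_iff intro: tendsto_within_subset)
  then have "(y - x) \<bullet> D \<le> f y - f x"
  proof (rule tendsto_upperbound)
    have "(f (x + t *\<^sub>R (y - x)) - f x) / t \<le> f y - f x" if "0 < t" "t < 1" for t
    proof -
      have "f ((1 - t) *\<^sub>R x + t *\<^sub>R y) \<le> (1 - t) * f x + t * f y"
        using that assms by (intro convex_onD[OF f]) auto
      also have "(1 - t) *\<^sub>R x + t *\<^sub>R y = x + t *\<^sub>R (y - x)"
        by (simp add: algebra_simps)
      finally show ?thesis
        using that by (simp add: field_simps)
    qed
    then show "\<forall>\<^sub>F t in at_right 0. (f (x + t *\<^sub>R (y - x)) - f x) / t \<le> f y - f x"
      by (auto simp: eventually_at_right[of 0 "1::real", OF zero_less_one] intro!: exI[of _ 1])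
  qed simp
  then show ?thesis
    by simp
qed

lemma concave_on_gradient_ge:
  assumes "concave_on S f" and "GDERIV f x :> D" and "x \<in> S" "y \<in> S"
  shows "f y \<le> f x + (y - x) \<bullet> D"
  using convex_on_gradient_le[of S "\<lambda>x. - f x" x "- D" y] GDERIV_minus[OF assms(2)] assms
  by (simp add: concave_on_def)

text \<open>Otherwise the midpoint would lie strictly below the common value. Minimality is asked
  for on the segment alone, since a saddle point supplies it only locally.\<close>

lemma strictly_convex_on_min_unique:
  assumes "strictly_convex_on S f" and "x \<in> S" "y \<in> S" "f x = f y"
    and "\<And>z. z \<in> closed_segment x y \<Longrightarrow> f x \<le> f z"
  shows "x = y"
proof (rule ccontr)
  assume "x \<noteq> y"
  then have "f ((1/2) *\<^sub>R x + (1/2) *\<^sub>R y) < 1/2 * f x + 1/2 * f y"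
    using assms(1-3) unfolding strictly_convex_on_def
    by (metis field_sum_of_halves half_gt_zero zero_less_one)
  moreover have "(1/2) *\<^sub>R x + (1/2) *\<^sub>R y \<in> closed_segment x y"
    by (auto simp: in_segment intro!: exI[of _ "1/2"])
  ultimately show False
    using assms(4,5) by fastforce
qed

section \<open>Dynamics near a saddle point\<close>

lemma saddle_point_field_zero:
  assumes G: "\<And>y. GDERIV F y :> G y" and p: "p \<in> Saddle F"
  shows "saddle_point_field F p = 0"
proof -
  obtain x z where xz: "p = (x, z)"
    by (cases p)
  obtain U V where UV: "open U" "x \<in> U" "open V" "z \<in> V"
    "\<And>x' z'. x' \<in> U \<Longrightarrow> z' \<in> V \<Longrightarrow> F (x, z') \<le> F (x, z) \<and> F (x, z) \<le> F (x', z)"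
    using p by (auto simp: Saddle_def is_saddle_point_def xz)
  have "fst (G (x, z)) = 0"
    using UV by (intro GDERIV_local_min_zero[OF GDERIV_fst[OF G], of U]) auto
  moreover have "snd (G (x, z)) = 0"
    using UV by (intro GDERIV_local_max_zero[OF GDERIV_snd[OF G], of V]) auto
  ultimately show ?thesis
    by (simp add: saddle_point_field_eq[OF G] xz zero_prod_def)
qed

text \<open>With zero gradient, the first-order inequalities make \<open>q\<close> extremal on both
  slices of \<open>U\<close> through it; a box inside \<open>U\<close> then supplies the two
  neighbourhoods of a saddle point.\<close>

lemma critical_point_is_saddle:
  assumes G: "\<And>y. GDERIV F y :> G y" and "open U" "q \<in> U"
    and cc: "\<And>x z. (x, z) \<in> U \<Longrightarrow> convex_on {x. (x, z) \<in> U} (\<lambda>x. F (x, z)) \<and>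
                     concave_on {z. (x, z) \<in> U} (\<lambda>z. F (x, z))"
    and "G q = 0"
  shows "q \<in> Saddle F"
proof -
  obtain x z where xz: "q = (x, z)"
    by (cases q)
  have "F (x, z) \<le> F (x', z)" if "(x', z) \<in> U" for x'
    using convex_on_gradient_le[OF _ GDERIV_fst[OF G], of "{x. (x, z) \<in> U}" z x x'] cc[of x z] that assms(3,5)
    by (simp add: xz)
  moreover have "F (x, z') \<le> F (x, z)" if "(x, z') \<in> U" for z'
    using concave_on_gradient_ge[OF _ GDERIV_snd[OF G], of "{z. (x, z) \<in> U}" x z z'] cc[of x z] that assms(3,5)
    by (simp add: xz)
  moreover obtain A B where AB: "open A" "open B" "(x, z) \<in> A \<times> B" "A \<times> B \<subseteq> U"
    using open_prod_elim[OF \<open>open U\<close> \<open>q \<in> U\<close>] by (metis xz)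
  ultimately have "\<forall>x'\<in>A. \<forall>z'\<in>B. F (x, z') \<le> F (x, z) \<and> F (x, z) \<le> F (x', z)"
    by blast
  then show ?thesis
    using AB(1-3) unfolding Saddle_def is_saddle_point_def xz by blast
qed

text \<open>By the gradient inequalities, the dissipation rate of the squared distance to the saddle
  point is bounded by the gap \<^term>\<open>F (fst p, snd y) - F (fst y, snd p)\<close>; strictness forces one
  component of each zero of the gap to agree with the saddle point, where the other component of
  the gradient vanishes by extremality.\<close>

lemma saddle_neighbourhood:
  assumes G: "\<And>y. GDERIV F y :> G y" and p: "p \<in> Saddle F"
    and scc: "locally_strictly_convex_concave_at F p"
  obtains r where "r > 0"
    and "\<And>y. y \<in> ball p r \<Longrightarrow>
           saddle_point_field F y \<bullet> (y - p) \<le> F (fst p, snd y) - F (fst y, snd p)"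
    and "\<And>y. y \<in> ball p r \<Longrightarrow> F (fst p, snd y) - F (fst y, snd p) \<le> 0"
    and "\<And>y. y \<in> ball p r \<Longrightarrow> saddle_point_field F y = 0 \<Longrightarrow> y \<in> Saddle F"
    and "(\<forall>y\<in>ball p r. F (fst p, snd y) - F (fst y, snd p) = 0 \<longrightarrow>
            fst y = fst p \<and> snd (saddle_point_field F y) = 0) \<or>
         (\<forall>y\<in>ball p r. F (fst p, snd y) - F (fst y, snd p) = 0 \<longrightarrow>
            snd y = snd p \<and> fst (saddle_point_field F y) = 0)"
proof -
  obtain a b where ab: "p = (a, b)"
    by (cases p)
  note field = saddle_point_field_eq[OF G]
  obtain A B where AB: "open A" "a \<in> A" "open B" "b \<in> B"
    "\<And>x z. x \<in> A \<Longrightarrow> z \<in> B \<Longrightarrow> F (a, z) \<le> F (a, b) \<and> F (a, b) \<le> F (x, b)"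
    using p by (auto simp: Saddle_def is_saddle_point_def ab)
  obtain U where U: "open U" "p \<in> U"
    and cc: "\<And>x z. (x, z) \<in> U \<Longrightarrow> convex_on {x. (x, z) \<in> U} (\<lambda>x. F (x, z)) \<and>
                     concave_on {z. (x, z) \<in> U} (\<lambda>z. F (x, z))"
    using scc by (fastforce simp: locally_strictly_convex_concave_at_def locally_convex_concave_at_def ab)
  obtain C D where CD: "open C" "a \<in> C" "open D" "b \<in> D"
    "strictly_convex_on C (\<lambda>x. F (x, b)) \<or> strictly_concave_on D (\<lambda>z. F (a, z))"
    using scc by (auto simp: locally_strictly_convex_concave_at_def ab)
  have "open (U \<inter> (A \<inter> C) \<times> (B \<inter> D))" "p \<in> U \<inter> (A \<inter> C) \<times> (B \<inter> D)"
    using U AB CD by (auto intro!: open_Int open_Times simp: ab)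
  then obtain r where r: "r > 0" "ball p r \<subseteq> U \<inter> (A \<inter> C) \<times> (B \<inter> D)"
    by (meson openE)
  \<comment> \<open>Replacing one coordinate by that of \<open>p\<close> does not increase the
    distance to \<open>p\<close>.\<close>
  have slices: "(a, z) \<in> ball p r" "(x, b) \<in> ball p r" if "(x, z) \<in> ball p r" for x z
    using that dist_snd_le[of "(a, b)" "(x, z)"] dist_fst_le[of "(a, b)" "(x, z)"]
    by (simp_all add: ab dist_Pair_Pair[of a b a] dist_Pair_Pair[of a b _ b])
  have opt: "F (a, z) \<le> F (a, b)" "F (a, b) \<le> F (x, b)" if "(x, z) \<in> ball p r" for x z
    using AB(5)[of x z] that r(2) by auto
  have diss: "saddle_point_field F (x, z) \<bullet> ((x, z) - p) \<le> F (a, z) - F (x, b)"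
    if y: "(x, z) \<in> ball p r" for x z
  proof -
    have U': "(x, z) \<in> U" "(a, z) \<in> U" "(x, b) \<in> U"
      using slices[OF y] y r(2) by auto
    \<comment> \<open>Both gradient inequalities are based at the current point
      \<open>(x, z)\<close>, so the term \<open>F (x, z)\<close> cancels when they are
      combined.\<close>
    have "F (x, z) + (a - x) \<bullet> fst (G (x, z)) \<le> F (a, z)"
      using U' cc[of x z] by (intro convex_on_gradient_le[OF _ GDERIV_fst[OF G], of "{x. (x, z) \<in> U}"]) auto
    moreover have "F (x, b) \<le> F (x, z) + (b - z) \<bullet> snd (G (x, z))"
      using U' cc[of x z] by (intro concave_on_gradient_ge[OF _ GDERIV_snd[OF G], of "{z. (x, z) \<in> U}"]) auto
    ultimately show ?thesis
      by (simp add: field ab inner_diff_left inner_diff_right inner_commute)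
  qed
  show ?thesis
  proof (rule that[OF r(1)])
    show "saddle_point_field F y \<bullet> (y - p) \<le> F (fst p, snd y) - F (fst y, snd p)"
      if "y \<in> ball p r" for y
      using diss[of "fst y" "snd y"] that by (simp add: ab)
    show "F (fst p, snd y) - F (fst y, snd p) \<le> 0" if "y \<in> ball p r" for y
      using opt[of "fst y" "snd y"] that by (simp add: ab)
    show "y \<in> Saddle F" if "y \<in> ball p r" "saddle_point_field F y = 0" for y
      using that r(2) by (intro critical_point_is_saddle[OF G U(1) _ cc])
        (auto simp: field zero_prod_def prod_eq_iff)
    \<comment> \<open>Inserting \<open>F (a, b)\<close> splits the gap into two nonpositive terms,
      so a zero gap makes both vanish.\<close>
    have eq: "F (a, z) = F (a, b)" "F (x, b) = F (a, b)"
      if "(x, z) \<in> ball p r" "F (a, z) - F (x, b) = 0" for x z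
      using opt[OF that(1)] that(2) by auto
    have x_eq: "x = a \<and> snd (G (x, z)) = 0"
      if sc: "strictly_convex_on C (\<lambda>x. F (x, b))" and y: "(x, z) \<in> ball p r"
        and 0: "F (a, z) - F (x, b) = 0" for x z
    proof
      have "(a, b) \<in> ball p r"
        using r(1) by (simp add: ab)
      \<comment> \<open>Points of the segment are no farther from \<open>a\<close> than
        \<open>x\<close> is, so the segment stays where the saddle inequality holds.\<close>
      have "F (a, b) \<le> F (x', b)" if "x' \<in> closed_segment a x" for x'
      proof -
        have "dist a x' \<le> dist a x"
          using that by (metis dist_commute segment_bound(1) dist_norm norm_minus_commute)
        then have "(x', b) \<in> ball p r"
          using slices(2)[OF y] by (simp add: ab dist_Pair_Pair)
        then show ?thesis
          by (rule opt(2))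
      qed
      then show "x = a"
        using sc y r(2) CD(2) eq(2)[OF y 0]
        by (intro strictly_convex_on_min_unique[of C "\<lambda>x. F (x, b)" a x, symmetric]) auto
      \<comment> \<open>Now that \<open>x = a\<close>, the point \<open>z\<close> attains the
        maximum \<open>F (a, b)\<close> of \<open>F (a, _)\<close> over the open set
        \<open>B\<close>.\<close>
      then show "snd (G (x, z)) = 0"
        using AB r(2) y eq(1)[OF y 0]
        by (intro GDERIV_local_max_zero[OF GDERIV_snd[OF G], of B]) auto
    qed
    have z_eq: "z = b \<and> fst (G (x, z)) = 0"
      if sc: "strictly_concave_on D (\<lambda>z. F (a, z))" and y: "(x, z) \<in> ball p r"
        and 0: "F (a, z) - F (x, b) = 0" for x z
    proof
      have "F (a, z') \<le> F (a, b)" if "z' \<in> closed_segment b z" for z'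
      proof -
        have "dist b z' \<le> dist b z"
          using that by (metis dist_commute segment_bound(1) dist_norm norm_minus_commute)
        then have "(a, z') \<in> ball p r"
          using slices(1)[OF y] by (simp add: ab dist_Pair_Pair)
        then show ?thesis
          by (rule opt(1))
      qed
      then show "z = b"
        using sc y r(2) CD(4) eq(1)[OF y 0] unfolding strictly_concave_on_def
        by (intro strictly_convex_on_min_unique[of D "\<lambda>z. - F (a, z)" b z, symmetric]) auto
      then show "fst (G (x, z)) = 0"
        using AB r(2) y eq(2)[OF y 0]
        by (intro GDERIV_local_min_zero[OF GDERIV_fst[OF G], of A]) auto
    qed
    show "(\<forall>y\<in>ball p r. F (fst p, snd y) - F (fst y, snd p) = 0 \<longrightarrow>
            fst y = fst p \<and> snd (saddle_point_field F y) = 0) \<or>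
         (\<forall>y\<in>ball p r. F (fst p, snd y) - F (fst y, snd p) = 0 \<longrightarrow>
            snd y = snd p \<and> fst (saddle_point_field F y) = 0)"
      using CD(5)
    proof
      assume "strictly_convex_on C (\<lambda>x. F (x, b))"
      then have "\<forall>y\<in>ball p r. F (fst p, snd y) - F (fst y, snd p) = 0 \<longrightarrow>
            fst y = fst p \<and> snd (saddle_point_field F y) = 0"
        using x_eq by (auto simp: ab field)
      then show ?thesis ..
    next
      assume "strictly_concave_on D (\<lambda>z. F (a, z))"
      then have "\<forall>y\<in>ball p r. F (fst p, snd y) - F (fst y, snd p) = 0 \<longrightarrow>
            snd y = snd p \<and> fst (saddle_point_field F y) = 0"
        using z_eq by (auto simp: ab field)
      then show ?thesis ..
    qed
  qed
qed

text \<open>Limit points exist by compactness and are zeros of the field, hence saddle points. Each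
  one has a dissipative ball of its own; the trajectory enters arbitrarily small balls around it and
  cannot leave them again.\<close>

lemma saddle_point_attraction:
  assumes F: "continuously_differentiable F" and p: "p \<in> Saddle F"
    and scc: "locally_strictly_convex_concave_on (Saddle F) F"
  shows "\<exists>r>0. \<forall>\<phi>. trajectory (saddle_point_field F) \<phi> \<and> \<phi> 0 \<in> ball p r \<longrightarrow>
    (\<forall>t\<ge>0. dist (\<phi> t) p \<le> dist (\<phi> 0) p) \<and> (\<exists>q\<in>Saddle F. (\<phi> \<longlongrightarrow> q) at_top)"
proof -
  define X where "X = saddle_point_field F"
  obtain G where G: "\<And>y. GDERIV F y :> G y" and contG: "continuous_on UNIV G"
    using F by (auto simp: continuously_differentiable_def)
  have contX: "continuous_on UNIV X"
    unfolding X_def saddle_point_field_eq[OF G] by (intro continuous_intros contG)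
  have contF: "continuous_on UNIV F"
    using G by (auto simp: gderiv_def continuous_on_eq_continuous_at intro: has_derivative_continuous)
  define g where "g = (\<lambda>y. F (fst p, snd y) - F (fst y, snd p))"
  have contg: "continuous_on UNIV g"
    unfolding g_def by (intro continuous_intros continuous_on_compose2[OF contF]) auto
  obtain r where "r > 0"
    and diss: "\<And>y. y \<in> ball p r \<Longrightarrow> X y \<bullet> (y - p) \<le> g y" "\<And>y. y \<in> ball p r \<Longrightarrow> g y \<le> 0"
    and crit: "\<And>y. y \<in> ball p r \<Longrightarrow> X y = 0 \<Longrightarrow> y \<in> Saddle F"
    and gap: "(\<forall>y\<in>ball p r. g y = 0 \<longrightarrow> fst y = fst p \<and> snd (X y) = 0) \<or>
         (\<forall>y\<in>ball p r. g y = 0 \<longrightarrow> snd y = snd p \<and> fst (X y) = 0)"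
    unfolding X_def g_def
    by (rule saddle_neighbourhood[OF G p])
      (use p scc in \<open>auto simp: locally_strictly_convex_concave_on_def\<close>)
  have "(\<forall>t\<ge>0. dist (\<phi> t) p \<le> dist (\<phi> 0) p) \<and> (\<exists>q\<in>Saddle F. (\<phi> \<longlongrightarrow> q) at_top)"
    if \<phi>: "trajectory X \<phi>" and start: "\<phi> 0 \<in> ball p r" for \<phi>
  proof
    show anti: "\<forall>t\<ge>0. dist (\<phi> t) p \<le> dist (\<phi> 0) p"
      using dissipative_dist_antimono[OF \<phi>, of p r 0] diss start by (meson order_refl order_trans)
    define K where "K = cball p (dist (\<phi> 0) p)"
    have K: "compact K" and in_K: "\<And>t. t \<ge> 0 \<Longrightarrow> \<phi> t \<in> K"
      using anti by (auto simp: K_def dist_commute)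
    have omega: "q \<in> ball p r" "g q = 0" if "q \<in> omega_limit \<phi>" for q
      using omega_limit_dissipation_zero[OF \<phi> contX contg diss start that] by auto
    have zero: "X q = 0" if q: "q \<in> omega_limit \<phi>" for q
      \<comment> \<open>The same alternative holds for all points of the ball, so one fixed
        component is constant on the whole limit set. Its velocity vanishes by that constancy, the
        other component of the field by the zero gap.\<close>
      using gap
    proof
      assume *: "\<forall>y\<in>ball p r. g y = 0 \<longrightarrow> fst y = fst p \<and> snd (X y) = 0"
      then have "fst (X q) = 0"
        using omega q by (intro omega_limit_linear_image_zero[OF \<phi> contX K in_K bounded_linear_fst]) auto
      then show ?thesis
        using * omega[OF q] by (simp add: prod_eq_iff)
    next
      assume *: "\<forall>y\<in>ball p r. g y = 0 \<longrightarrow> snd y = snd p \<and> fst (X y) = 0"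
      then have "snd (X q) = 0"
        using omega q by (intro omega_limit_linear_image_zero[OF \<phi> contX K in_K bounded_linear_snd]) auto
      then show ?thesis
        using * omega[OF q] by (simp add: prod_eq_iff)
    qed
    have "\<exists>\<^sub>F t in at_top. \<phi> t \<in> K"
      using in_K by (intro eventually_frequently) (auto simp: eventually_at_top_linorder)
    then obtain q where q: "q \<in> omega_limit \<phi>"
      using omega_limit_meets_compact[OF K] by blast
    have "q \<in> Saddle F"
      using crit omega[OF q] zero[OF q] by blast
    obtain r' where "r' > 0"
      and "\<And>y. y \<in> ball q r' \<Longrightarrow> X y \<bullet> (y - q) \<le> F (fst q, snd y) - F (fst y, snd q)"
      and "\<And>y. y \<in> ball q r' \<Longrightarrow> F (fst q, snd y) - F (fst y, snd q) \<le> 0"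
      unfolding X_def
      by (rule saddle_neighbourhood[OF G \<open>q \<in> Saddle F\<close>])
        (use \<open>q \<in> Saddle F\<close> scc in \<open>auto simp: locally_strictly_convex_concave_on_def\<close>)
    then have r': "r' > 0" "\<And>y. y \<in> ball q r' \<Longrightarrow> X y \<bullet> (y - q) \<le> 0"
      using order_trans by blast+
    have "\<forall>\<^sub>F t in at_top. dist (\<phi> t) q < e" if "e > 0" for e
    proof -
      \<comment> \<open>Being below \<open>r'\<close> makes the distance to \<open>q\<close>
        nonincreasing from then on; being below \<open>e\<close> then settles convergence.\<close>
      have "\<exists>\<^sub>F t in at_top. dist (\<phi> t) q < min e r'"
        using q that r'(1) min_less_iff_conj[of 0 e r'] unfolding omega_limit_def by blast
      then have "\<exists>\<^sub>F t in at_top. dist (\<phi> t) q < min e r' \<and> t \<ge> 0"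
        by (rule frequently_eventually_frequently) (rule eventually_ge_at_top)
      then obtain s where s: "dist (\<phi> s) q < min e r'" "s \<ge> 0"
        using frequently_ex by blast
      have "dist (\<phi> t) q < e" if "t \<ge> s" for t
        using dissipative_dist_antimono[of X \<phi> q r' s t] \<phi> r'(2) s that by (simp add: dist_commute)
      then show ?thesis
        by (auto simp: eventually_at_top_linorder)
    qed
    then have "(\<phi> \<longlongrightarrow> q) at_top"
      by (simp add: tendsto_iff)
    with \<open>q \<in> Saddle F\<close> show "\<exists>q\<in>Saddle F. (\<phi> \<longlongrightarrow> q) at_top" ..
  qed
  with \<open>r > 0\<close> show ?thesis
    unfolding X_def by blast
qed

section \<open>From single saddle points to isolated components\<close>

theorem proposition4p1:
  fixes F :: "(real ^ 'n) \<times> (real ^ 'm) \<Rightarrow> real"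
    and Sc :: "((real ^ 'n) \<times> (real ^ 'm)) set"
  assumes "continuously_differentiable F"
    and "Saddle F \<noteq> {}"
    and "locally_strictly_convex_concave_on (Saddle F) F"
    and "isolated_path_component Sc (Saddle F)"
  shows "locally_asymptotically_stable (saddle_point_field F) Sc
       \<and> convergence_to_a_point (saddle_point_field F) Sc"
proof -
  define X where "X = saddle_point_field F"
  obtain U where U: "open U" "Sc \<subseteq> U" "U \<inter> Saddle F = Sc"
    using assms(4) by (auto simp: isolated_path_component_def)
  obtain G where G: "\<And>y. GDERIV F y :> G y"
    using assms(1) by (auto simp: continuously_differentiable_def)
  have equilibria: "X p = 0" if "p \<in> Sc" for p
    unfolding X_def using U that by (intro saddle_point_field_zero[OF G]) auto
  have "\<exists>r>0. \<forall>\<phi>. trajectory X \<phi> \<and> \<phi> 0 \<in> ball p r \<longrightarrow>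
      (\<forall>t\<ge>0. dist (\<phi> t) p < \<epsilon>) \<and> (\<exists>q\<in>Sc. (\<phi> \<longlongrightarrow> q) at_top)"
    if p: "p \<in> Sc" and "\<epsilon> > 0" for p \<epsilon>
  proof -
    obtain r where r: "r > 0" "\<And>\<phi>. trajectory X \<phi> \<Longrightarrow> \<phi> 0 \<in> ball p r \<Longrightarrow>
      (\<forall>t\<ge>0. dist (\<phi> t) p \<le> dist (\<phi> 0) p) \<and> (\<exists>q\<in>Saddle F. (\<phi> \<longlongrightarrow> q) at_top)"
      using saddle_point_attraction[OF assms(1) _ assms(3), of p] p U(3) unfolding X_def by blast
    \<comment> \<open>Distances to \<open>p\<close> do not grow, so a start within
      \<open>\<rho>\<close> keeps the limit in the isolating set \<open>U\<close>, whose saddle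
      points all belong to \<open>Sc\<close>.\<close>
    obtain \<rho> where \<rho>: "\<rho> > 0" "ball p \<rho> \<subseteq> U"
      using U p by (meson openE subsetD)
    have "(\<forall>t\<ge>0. dist (\<phi> t) p < \<epsilon>) \<and> (\<exists>q\<in>Sc. (\<phi> \<longlongrightarrow> q) at_top)"
      if "trajectory X \<phi>" "\<phi> 0 \<in> ball p (min \<epsilon> (min r \<rho>))" for \<phi>
    proof
      have start: "dist (\<phi> 0) p < \<epsilon>" "dist (\<phi> 0) p < r" "dist (\<phi> 0) p < \<rho>"
        using that by (auto simp: dist_commute)
      have near: "\<forall>t\<ge>0. dist (\<phi> t) p \<le> dist (\<phi> 0) p"
        and "\<exists>q\<in>Saddle F. (\<phi> \<longlongrightarrow> q) at_top"
        using r(2)[OF that(1)] start(2) by (auto simp: dist_commute)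
      then obtain q where q: "q \<in> Saddle F" "(\<phi> \<longlongrightarrow> q) at_top"
        by blast
      show "\<forall>t\<ge>0. dist (\<phi> t) p < \<epsilon>"
        using near start(1) by force
      have "dist q p \<le> dist (\<phi> 0) p"
        using near q(2) by (intro tendsto_upperbound[OF tendsto_dist[OF q(2) tendsto_const]])
          (auto simp: eventually_at_top_linorder)
      then have "q \<in> U"
        using start(3) \<rho>(2) by (auto simp: dist_commute)
      then show "\<exists>q\<in>Sc. (\<phi> \<longlongrightarrow> q) at_top"
        using q U(3) by blast
    qed
    then show ?thesis
      using \<open>\<epsilon> > 0\<close> r(1) \<rho>(1) by (intro exI[of _ "min \<epsilon> (min r \<rho>)"]) auto
  qed
  then obtain r where r: "\<And>p \<epsilon>. p \<in> Sc \<Longrightarrow> \<epsilon> > 0 \<Longrightarrow> r p \<epsilon> > 0"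
    "\<And>p \<epsilon> \<phi>. p \<in> Sc \<Longrightarrow> \<epsilon> > 0 \<Longrightarrow> trajectory X \<phi> \<Longrightarrow> \<phi> 0 \<in> ball p (r p \<epsilon>) \<Longrightarrow>
      (\<forall>t\<ge>0. dist (\<phi> t) p < \<epsilon>) \<and> (\<exists>q\<in>Sc. (\<phi> \<longlongrightarrow> q) at_top)"
    by metis
  \<comment> \<open>The radius depends on the point and may shrink along \<open>Sc\<close>, hence a
    union of balls. The bound \<open>\<epsilon>\<close> is common to all of them and passes to
    \<open>infdist\<close>, which is at most the distance to the chosen centre.\<close>
  define W where "W = (\<lambda>\<epsilon>. \<Union>p\<in>Sc. ball p (r p \<epsilon>))"
  have W: "open (W \<epsilon>)" "Sc \<subseteq> W \<epsilon>" if "\<epsilon> > 0" for \<epsilon>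
    using r(1) that by (auto simp: W_def)
  have stable: "infdist (\<phi> t) Sc < \<epsilon>"
    if "\<epsilon> > 0" "trajectory X \<phi>" and start: "\<phi> 0 \<in> W \<epsilon>" and "t \<ge> 0" for \<epsilon> \<phi> t
  proof -
    obtain p where "p \<in> Sc" "\<phi> 0 \<in> ball p (r p \<epsilon>)"
      using start by (auto simp: W_def)
    then show ?thesis
      using r(2) that infdist_le[of p Sc "\<phi> t"] by fastforce
  qed
  \<comment> \<open>Any positive tolerance would serve in place of 1, as convergence holds from each
    \<open>W \<epsilon>\<close>.\<close>
  have limit: "\<exists>q\<in>Sc. (\<phi> \<longlongrightarrow> q) at_top" if "trajectory X \<phi>" "\<phi> 0 \<in> W 1" for \<phi>
    using that r(2)[of _ 1] by (auto simp: W_def)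
  have attract: "((\<lambda>t. infdist (\<phi> t) Sc) \<longlongrightarrow> 0) at_top"
    if \<phi>: "trajectory X \<phi>" "\<phi> 0 \<in> W 1" for \<phi>
  proof -
    obtain q where "q \<in> Sc" "(\<phi> \<longlongrightarrow> q) at_top"
      using limit[OF \<phi>] by blast
    then show ?thesis
      using tendsto_infdist[of \<phi> q at_top Sc] by simp
  qed
  have "locally_asymptotically_stable X Sc"
    unfolding locally_asymptotically_stable_def
    using equilibria W stable attract by (metis zero_less_one)
  moreover have "convergence_to_a_point X Sc"
    unfolding convergence_to_a_point_def using W limit by (metis zero_less_one)
  ultimately show ?thesis
    by (simp add: X_def)
qed

end
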